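(* On $\mathbb{R}^d$ let $c(x,y)=\|x-y\|^2$ and let $\varepsilon>0$. Let $\mu_0,\mu_1\in\mathcal{P}(\mathbb{R}^d)$ have bounded support and means $m_0,m_1\in\mathbb{R}^d$. Their centered versions $\bar\mu_i=(\mathrm{id}-m_i)_\#\mu_i$, $i=0,1$, satisfy $$S_\varepsilon(\mu_0,\mu_1)=\|m_1-m_0\|^2+S_\varepsilon(\bar\mu_0,\bar\mu_1).$$
   Context: $\mathcal{P}(\mathbb{R}^d)$: Borel probability measures; $T_\#\mu$ denotes the pushforward of $\mu$ by $T$; the mean of $\mu$ is $\int x\,d\mu(x)$. $\mathrm{OT}_\varepsilon(\mu,\nu)=\inf_{\pi\in\Pi(\mu,\nu)}\iint c\,d\pi+\varepsilon\,\mathrm{KL}(\pi\,|\,\mu\otimes\nu)$, where $\Pi(\mu,\nu)$ is the set of couplings of $\mu$ and $\nu$ and $\mathrm{KL}$ is the Kullback--Leibler divergence ($+\infty$ if $\pi\not\ll\mu\otimes\nu$). $S_\varepsilon(\mu,\nu)=\mathrm{OT}_\varepsilon(\mu,\nu)-\frac12\mathrm{OT}_\varepsilon(\mu,\mu)-\frac12\mathrm{OT}_\varepsilon(\nu,\nu)$. *)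

theory Defs
  imports "HOL-Probability.Probability"
begin

definition measure_support :: "'a::topological_space measure \<Rightarrow> 'a set" where
  "measure_support \<mu> = {x. \<forall>U. open U \<longrightarrow> x \<in> U \<longrightarrow> 0 < emeasure \<mu> U}"

definition couplings :: "'a measure \<Rightarrow> 'b measure \<Rightarrow> ('a \<times> 'b) measure set" where
  "couplings \<mu> \<nu> = {\<pi>. prob_space \<pi> \<and> sets \<pi> = sets (\<mu> \<Otimes>\<^sub>M \<nu>) \<and>
     distr \<pi> \<mu> fst = \<mu> \<and> distr \<pi> \<nu> snd = \<nu>}"

text \<open>
  \<open>KL P Q\<close> is the divergence of \<open>P\<close> relative to \<open>Q\<close>, with natural logarithm and values in the
  extended reals. The library's \<^const>\<open>KL_divergence\<close> takes the reference measure first, and being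
  a Bochner integral it is 0 when the log-density is not integrable. For probability measures
  \<open>P \<ll> Q\<close> on the same sigma-algebra, the negative part of the log-density is always
  \<open>P\<close>-integrable, so non-integrability means that the integral is \<open>+\<infinity>\<close>.
\<close>

definition KL :: "'a measure \<Rightarrow> 'a measure \<Rightarrow> ereal" where
  "KL P Q =
     (if absolutely_continuous Q P \<and> integrable P (entropy_density (exp 1) Q P)
      then ereal (KL_divergence (exp 1) Q P) else \<infinity>)"

definition OT :: "('a \<Rightarrow> 'b \<Rightarrow> ennreal) \<Rightarrow> real \<Rightarrow> 'a measure \<Rightarrow> 'b measure \<Rightarrow> ereal" where
  "OT c \<epsilon> \<mu> \<nu> =
     (INF \<pi> \<in> couplings \<mu> \<nu>.
        enn2ereal (\<integral>\<^sup>+ (x, y). c x y \<partial>\<pi>) + ereal \<epsilon> * KL \<pi> (\<mu> \<Otimes>\<^sub>M \<nu>))"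

definition sinkhorn_divergence ::
    "('a \<Rightarrow> 'a \<Rightarrow> ennreal) \<Rightarrow> real \<Rightarrow> 'a measure \<Rightarrow> 'a measure \<Rightarrow> ereal" where
  "sinkhorn_divergence c \<epsilon> \<mu> \<nu> =
     OT c \<epsilon> \<mu> \<nu> - ereal (1/2) * OT c \<epsilon> \<mu> \<mu> - ereal (1/2) * OT c \<epsilon> \<nu> \<nu>"

definition sq_dist_cost :: "'a::real_normed_vector \<Rightarrow> 'a \<Rightarrow> ennreal" where
  "sq_dist_cost x y = ennreal ((norm (x - y))\<^sup>2)"

end

theory Submission
  imports Defs
begin

text \<open>
  The translation \<open>(x, y) \<mapsto> (x - a, y - b)\<close> carries the couplings of two measures bijectively onto
  the couplings of the translated measures and leaves the relative entropy with respect to the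
  product measure unchanged. It lowers the squared distance by the affine function
  \<open>2 (x - y) \<bullet> (a - b) - \<parallel>a - b\<parallel>\<^sup>2\<close>, whose integral is the same for all couplings.
  Hence the two entropic transport costs differ by an explicit constant: it is \<open>\<parallel>m\<^sub>1 - m\<^sub>0\<parallel>\<^sup>2\<close> when
  \<open>a, b\<close> are the means, and \<open>0\<close> for the two self-transport terms.
\<close>

section \<open>Bounded support and existence of means\<close>

text \<open>The complement of the support is the union of all open null sets; by Lindelof countably
  many of them already cover it, so it is null.\<close>

lemma AE_in_measure_support:
  fixes \<mu> :: "'a::second_countable_topology measure"
  assumes "sets \<mu> = sets borel"
  shows "AE x in \<mu>. x \<in> measure_support \<mu>"
proof -
  define \<F> where "\<F> = {U. open U \<and> emeasure \<mu> U = 0}"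
  obtain \<F>' where F': "\<F>' \<subseteq> \<F>" "countable \<F>'" "\<Union>\<F>' = \<Union>\<F>"
    using Lindelof[of \<F>] by (auto simp: \<F>_def)
  have "(\<Union>U\<in>\<F>'. U) \<in> null_sets \<mu>"
    using F'(1) assms by (intro null_sets_UN' F'(2)) (auto simp: \<F>_def intro!: null_setsI)
  then have "\<Union>\<F> \<in> null_sets \<mu>"
    using F'(3) by simp
  then have "AE x in \<mu>. x \<notin> \<Union>\<F>"
    by (rule AE_not_in)
  then show ?thesis
    by eventually_elim (auto simp: \<F>_def measure_support_def zero_less_iff_neq_zero)
qed

text \<open>This is where bounded support enters: it makes the means genuine integrals, so that
  affine functions can be integrated against couplings.\<close>

lemma integrable_id_bounded_support:
  fixes M :: "'a::euclidean_space measure"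
  assumes "finite_measure M" and "sets M = sets borel" and "bounded (measure_support M)"
  shows "integrable M (\<lambda>x. x)"
proof -
  obtain B where B: "\<And>x. x \<in> measure_support M \<Longrightarrow> norm x \<le> B"
    using assms(3) by (auto simp: bounded_iff)
  have "AE x in M. norm x \<le> B"
    using AE_in_measure_support[OF assms(2)] by eventually_elim (rule B)
  moreover have "(\<lambda>x. x) \<in> borel_measurable M"
    using assms(2) by (simp add: measurable_ident_sets)
  ultimately show ?thesis
    by (rule finite_measure.integrable_const_bound[OF assms(1)])
qed

section \<open>Relative entropy under an invertible change of variables\<close>

lemma distr_inverse:
  assumes "T \<in> measurable M M'" "T' \<in> measurable M' M" "\<And>x. x \<in> space M \<Longrightarrow> T' (T x) = x"
  shows "distr (distr M M' T) M T' = M"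
proof -
  have "distr (distr M M' T) M T' = distr M M (\<lambda>x. x)"
    unfolding distr_distr[OF assms(2,1)] using assms(3) by (intro distr_cong) auto
  then show ?thesis
    by (simp add: distr_id)
qed

lemma absolutely_continuous_distr:
  assumes ac: "absolutely_continuous M N" and sets: "sets N = sets M" and T: "T \<in> measurable M M'"
  shows "absolutely_continuous (distr M M' T) (distr N M' T)"
proof -
  have TN: "T \<in> measurable N M'"
    using T sets by (simp cong: measurable_cong_sets)
  show ?thesis
    using ac sets_eq_imp_space_eq[OF sets] null_sets_distr_iff[OF T] null_sets_distr_iff[OF TN]
    by (auto simp: absolutely_continuous_def)
qed

text \<open>A map with a measurable left inverse loses no information: the density of the image
  measures at \<open>T x\<close> is the original density at \<open>x\<close>, and integrating its
  logarithm is a change of variables.\<close>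

lemma KL_distr:
  assumes "sigma_finite_measure Q" and sets: "sets P = sets Q"
    and T: "T \<in> measurable Q M'" and T': "T' \<in> measurable M' Q"
    and inv: "\<And>x. x \<in> space Q \<Longrightarrow> T' (T x) = x"
  shows "KL (distr P M' T) (distr Q M' T) = KL P Q"
proof -
  interpret Q: sigma_finite_measure Q by fact
  let ?P = "distr P M' T" and ?Q = "distr Q M' T"
  have TP: "T \<in> measurable P M'"
    using T sets by (simp cong: measurable_cong_sets)
  have T'P: "T' \<in> measurable M' P"
    using T' sets by (simp cong: measurable_cong_sets)
  have invP: "x \<in> space P \<Longrightarrow> T' (T x) = x" for x
    using inv sets_eq_imp_space_eq[OF sets] by simp
  have ac_iff: "absolutely_continuous ?Q ?P \<longleftrightarrow> absolutely_continuous Q P"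
  proof
    \<comment> \<open>Pushing forward once more along \<open>T'\<close> recovers the original pair,
      so this direction follows from the other one.\<close>
    assume "absolutely_continuous ?Q ?P"
    then have "absolutely_continuous (distr ?Q Q T') (distr ?P Q T')"
      by (rule absolutely_continuous_distr) (simp_all add: sets T')
    moreover have "distr ?P P T' = P"
      using TP T'P invP by (rule distr_inverse)
    moreover have "distr ?P Q T' = distr ?P P T'"
      using sets by (intro distr_cong) auto
    moreover have "distr ?Q Q T' = Q"
      using T T' inv by (rule distr_inverse)
    ultimately show "absolutely_continuous Q P"
      by simp
  next
    assume "absolutely_continuous Q P"
    then show "absolutely_continuous ?Q ?P"
      using sets T by (rule absolutely_continuous_distr)
  qed
  show ?thesis
  proof (cases "absolutely_continuous Q P")
    case True
    let ?d = "entropy_density (exp 1) Q P" and ?d' = "entropy_density (exp 1) ?Q ?P"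
    have "AE x in Q. RN_deriv ?Q ?P (T x) = RN_deriv Q P x"
      using Q.RN_deriv_distr[OF T T' _ _ sets] inv True ac_iff by blast
    \<comment> \<open>The log-density is integrated against \<open>P\<close>, so the exceptional
      \<open>Q\<close>-null set has to be \<open>P\<close>-null too.\<close>
    then have "AE x in P. RN_deriv ?Q ?P (T x) = RN_deriv Q P x"
      by (rule absolutely_continuous_AE[OF sets True])
    then have AE: "AE x in P. ?d' (T x) = ?d x"
      by eventually_elim (simp add: entropy_density_def)
    have d: "?d \<in> borel_measurable P"
      using measurable_entropy_density[of "exp 1" Q P] sets by (simp cong: measurable_cong_sets)
    have d': "?d' \<in> borel_measurable M'"
      using measurable_entropy_density[of "exp 1" ?Q ?P] by simp
    have d'T: "(\<lambda>x. ?d' (T x)) \<in> borel_measurable P"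
      using measurable_compose[OF TP d'] .
    \<comment> \<open>\<open>KL\<close> is \<infinity> when the log-density is not integrable, so
      integrability is transferred as well as the integral.\<close>
    have "integrable ?P ?d' \<longleftrightarrow> integrable P ?d"
      using integrable_distr_eq[OF TP d'] integrable_cong_AE[OF d'T d AE] by simp
    moreover have "integral\<^sup>L ?P ?d' = integral\<^sup>L P ?d"
      using integral_distr[OF TP d'] integral_cong_AE[OF d'T d AE] by simp
    ultimately show ?thesis
      using True ac_iff by (simp add: KL_def KL_divergence_def)
  qed (simp add: KL_def ac_iff)
qed

section \<open>Couplings and the change of cost under translation\<close>

lemma distr_coupling:
  assumes \<pi>: "\<pi> \<in> couplings \<mu> \<nu>" and f: "f \<in> measurable \<mu> M" and g: "g \<in> measurable \<nu> N"
  shows "distr \<pi> (M \<Otimes>\<^sub>M N) (\<lambda>(x, y). (f x, g y)) \<in> couplings (distr \<mu> M f) (distr \<nu> N g)"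
proof -
  interpret \<pi>: prob_space \<pi>
    using \<pi> by (simp add: couplings_def)
  have sets[measurable_cong]: "sets \<pi> = sets (\<mu> \<Otimes>\<^sub>M \<nu>)"
    and fst: "distr \<pi> \<mu> fst = \<mu>" and snd: "distr \<pi> \<nu> snd = \<nu>"
    using \<pi> by (auto simp: couplings_def)
  note [measurable] = f g
  let ?T = "\<lambda>(x, y). (f x, g y)"
  let ?\<pi> = "distr \<pi> (M \<Otimes>\<^sub>M N) ?T"
  have T: "?T \<in> measurable \<pi> (M \<Otimes>\<^sub>M N)"
    by measurable
  have "distr ?\<pi> M fst = distr (distr \<pi> \<mu> fst) M f"
    by (simp add: distr_distr comp_def split_beta)
  moreover have "distr ?\<pi> N snd = distr (distr \<pi> \<nu> snd) N g"
    by (simp add: distr_distr comp_def split_beta)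
  \<comment> \<open>In \<open>couplings\<close> the marginal measure itself serves as target space;
    \<open>distr\<close> depends on the target only through its measurable sets.\<close>
  moreover have "distr ?\<pi> (distr \<mu> M f) fst = distr ?\<pi> M fst"
    "distr ?\<pi> (distr \<nu> N g) snd = distr ?\<pi> N snd"
    by (auto intro!: distr_cong)
  moreover have "sets ?\<pi> = sets (distr \<mu> M f \<Otimes>\<^sub>M distr \<nu> N g)"
    by (simp cong: sets_pair_measure_cong)
  ultimately show ?thesis
    using \<pi>.prob_space_distr[OF T] by (simp add: couplings_def fst snd)
qed

text \<open>The integrals of \<open>f\<close> and \<open>g\<close> may be infinite while
  \<open>L\<close> changes sign. Moving the negative part of \<open>L\<close> to the left-hand side
  keeps every integrand nonnegative.\<close>

lemma nn_integral_add_integrable: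
  fixes f g L :: "'a \<Rightarrow> real"
  assumes [measurable]: "f \<in> borel_measurable M" "g \<in> borel_measurable M"
    and L: "integrable M L"
    and nonneg: "\<And>x. 0 \<le> f x" "\<And>x. 0 \<le> g x" and eq: "\<And>x. f x = g x + L x"
  shows "enn2ereal (\<integral>\<^sup>+x. ennreal (f x) \<partial>M) =
    enn2ereal (\<integral>\<^sup>+x. ennreal (g x) \<partial>M) + ereal (\<integral>x. L x \<partial>M)"
proof -
  have [measurable]: "L \<in> borel_measurable M"
    using L by simp
  have fin: "(\<integral>\<^sup>+x. ennreal (L x) \<partial>M) \<noteq> \<infinity>" "(\<integral>\<^sup>+x. ennreal (- L x) \<partial>M) \<noteq> \<infinity>"
    using L by (auto simp: real_integrable_def)
  then obtain p n where p: "(\<integral>\<^sup>+x. ennreal (L x) \<partial>M) = ennreal p" "0 \<le> p"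
    and n: "(\<integral>\<^sup>+x. ennreal (- L x) \<partial>M) = ennreal n" "0 \<le> n"
    by (metis ennreal_cases infinity_ennreal_def)
  \<comment> \<open>As \<open>ennreal\<close> sends negative reals to 0,
    \<open>ennreal (L x)\<close> and \<open>ennreal (- L x)\<close> are the positive and negative
    parts of \<open>L x\<close>.\<close>
  have "ennreal (f x) + ennreal (- L x) = ennreal (g x) + ennreal (L x)" for x
    using nonneg[of x] eq[of x]
    by (cases "0 \<le> L x") (auto simp: ennreal_neg simp flip: ennreal_plus)
  then have "(\<integral>\<^sup>+x. ennreal (f x) \<partial>M) + ennreal n = (\<integral>\<^sup>+x. ennreal (g x) \<partial>M) + ennreal p"
    by (simp flip: p(1) n(1) nn_integral_add)
  then have "enn2ereal (\<integral>\<^sup>+x. ennreal (f x) \<partial>M) + ereal n =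
      enn2ereal (\<integral>\<^sup>+x. ennreal (g x) \<partial>M) + ereal p"
    using p(2) n(2) by (metis enn2ereal_ennreal plus_ennreal.rep_eq)
  moreover have "(\<integral>x. L x \<partial>M) = p - n"
    using real_lebesgue_integral_def[OF L] p n by simp
  ultimately show ?thesis
    by (cases "enn2ereal (\<integral>\<^sup>+x. ennreal (f x) \<partial>M)";
        cases "enn2ereal (\<integral>\<^sup>+x. ennreal (g x) \<partial>M)") auto
qed

text \<open>The change in cost is affine in \<open>(x, y)\<close>, so its integral sees a coupling
  only through the means of its marginals.\<close>

lemma coupling_sq_dist_translate:
  fixes \<mu> \<nu> :: "'a::euclidean_space measure" and a b :: 'a
  assumes \<pi>: "\<pi> \<in> couplings \<mu> \<nu>"
    and sets_borel: "sets \<mu> = sets borel" "sets \<nu> = sets borel"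
    and int: "integrable \<mu> (\<lambda>x. x)" "integrable \<nu> (\<lambda>x. x)"
  shows "enn2ereal (\<integral>\<^sup>+(x, y). sq_dist_cost x y \<partial>\<pi>) =
    enn2ereal (\<integral>\<^sup>+(x, y). sq_dist_cost (x - a) (y - b) \<partial>\<pi>) +
    ereal (2 * (((\<integral>x. x \<partial>\<mu>) - (\<integral>x. x \<partial>\<nu>)) \<bullet> (a - b)) - (norm (a - b))\<^sup>2)"
proof -
  interpret \<pi>: prob_space \<pi>
    using \<pi> by (simp add: couplings_def)
  have sets[measurable_cong]: "sets \<pi> = sets (borel \<Otimes>\<^sub>M borel)"
    using \<pi> sets_borel by (simp add: couplings_def cong: sets_pair_measure_cong)
  have fst: "\<mu> = distr \<pi> borel fst"
    using \<pi> sets_borel by (auto simp: couplings_def cong: distr_cong)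
  have snd: "\<nu> = distr \<pi> borel snd"
    using \<pi> sets_borel by (auto simp: couplings_def cong: distr_cong)
  have [measurable]: "fst \<in> borel_measurable \<pi>" "snd \<in> borel_measurable \<pi>"
    by measurable
  have int_fst: "integrable \<pi> fst" and int_snd: "integrable \<pi> snd"
    using integrable_distr[of fst \<pi> borel "\<lambda>x. x"] integrable_distr[of snd \<pi> borel "\<lambda>x. x"] int
    by (simp_all flip: fst snd)
  have means: "(\<integral>x. x \<partial>\<mu>) = (\<integral>z. fst z \<partial>\<pi>)" "(\<integral>x. x \<partial>\<nu>) = (\<integral>z. snd z \<partial>\<pi>)"
    by (subst fst snd, rule integral_distr; simp)+
  \<comment> \<open>Comes from expanding the square of \<open>(x - y) - (a - b)\<close> and solving
    for the square of \<open>x - y\<close>.\<close>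
  define L where "L = (\<lambda>z::'a \<times> 'a. 2 * ((fst z - snd z) \<bullet> (a - b)) - (norm (a - b))\<^sup>2)"
  have int_L: "integrable \<pi> L"
    unfolding L_def using int_fst int_snd by simp
  have mean_L: "(\<integral>z. L z \<partial>\<pi>) =
      2 * (((\<integral>z. fst z \<partial>\<pi>) - (\<integral>z. snd z \<partial>\<pi>)) \<bullet> (a - b)) - (norm (a - b))\<^sup>2"
    unfolding L_def using int_fst int_snd by (simp add: \<pi>.prob_space)
  have eq: "(norm (fst z - snd z))\<^sup>2 = (norm ((fst z - a) - (snd z - b)))\<^sup>2 + L z" for z
    unfolding L_def power2_norm_eq_inner
    by (simp add: inner_diff_left inner_diff_right inner_commute algebra_simps)
  have "enn2ereal (\<integral>\<^sup>+z. ennreal ((norm (fst z - snd z))\<^sup>2) \<partial>\<pi>) =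
      enn2ereal (\<integral>\<^sup>+z. ennreal ((norm ((fst z - a) - (snd z - b)))\<^sup>2) \<partial>\<pi>) + ereal (\<integral>z. L z \<partial>\<pi>)"
    by (rule nn_integral_add_integrable[OF _ _ int_L _ _ eq]) simp_all
  then show ?thesis
    by (simp add: sq_dist_cost_def split_beta' means mean_L)
qed

section \<open>Translation of the entropic transport cost\<close>

text \<open>Every coupling of \<open>\<mu>\<close> and \<open>\<nu>\<close>, once translated,
  competes in the infimum for the translated measures, with equal entropy and a cost lower by
  exactly the constant. No minimizer has to exist.\<close>

lemma OT_translate_le:
  fixes \<mu> \<nu> :: "'a::euclidean_space measure" and a b :: 'a
  assumes prob: "prob_space \<mu>" "prob_space \<nu>"
    and sets_borel: "sets \<mu> = sets borel" "sets \<nu> = sets borel"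
    and int: "integrable \<mu> (\<lambda>x. x)" "integrable \<nu> (\<lambda>x. x)"
  shows "OT sq_dist_cost \<epsilon> (distr \<mu> borel (\<lambda>x. x - a)) (distr \<nu> borel (\<lambda>x. x - b)) +
      ereal (2 * (((\<integral>x. x \<partial>\<mu>) - (\<integral>x. x \<partial>\<nu>)) \<bullet> (a - b)) - (norm (a - b))\<^sup>2)
    \<le> OT sq_dist_cost \<epsilon> \<mu> \<nu>" (is "?OT + ereal ?r \<le> _")
  unfolding OT_def[of _ _ \<mu>]
proof (rule INF_greatest)
  fix \<pi> assume \<pi>: "\<pi> \<in> couplings \<mu> \<nu>"
  interpret \<mu>: prob_space \<mu> by fact
  interpret \<nu>: prob_space \<nu> by fact
  interpret \<mu>\<nu>: pair_prob_space \<mu> \<nu> ..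
  note [measurable_cong] = sets_borel
  let ?T = "\<lambda>(x, y). (x - a, y - b)"
  let ?\<mu> = "distr \<mu> borel (\<lambda>x. x - a)" and ?\<nu> = "distr \<nu> borel (\<lambda>x. x - b)"
  let ?\<pi> = "distr \<pi> (borel \<Otimes>\<^sub>M borel) ?T"
  have sets: "sets \<pi> = sets (\<mu> \<Otimes>\<^sub>M \<nu>)"
    using \<pi> by (simp add: couplings_def)
  have sets'[measurable_cong]: "sets \<pi> = sets (borel \<Otimes>\<^sub>M borel)"
    using sets sets_borel by (simp cong: sets_pair_measure_cong)
  have [measurable]: "(\<lambda>(x::'a, y). sq_dist_cost x y) \<in> borel_measurable (borel \<Otimes>\<^sub>M borel)"
    unfolding sq_dist_cost_def by measurable
  have "prob_space ?\<nu>"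
    by (rule \<nu>.prob_space_distr) measurable
  then interpret \<nu>': prob_space ?\<nu> .
  have prod: "?\<mu> \<Otimes>\<^sub>M ?\<nu> = distr (\<mu> \<Otimes>\<^sub>M \<nu>) (borel \<Otimes>\<^sub>M borel) ?T"
    by (rule pair_measure_distr) (simp_all add: \<nu>'.sigma_finite_measure_axioms)
  have "KL ?\<pi> (?\<mu> \<Otimes>\<^sub>M ?\<nu>) = KL \<pi> (\<mu> \<Otimes>\<^sub>M \<nu>)"
    unfolding prod
    by (rule KL_distr[where T' = "\<lambda>(x, y). (x + a, y + b)"])
      (auto simp: sets \<mu>\<nu>.sigma_finite_measure_axioms)
  moreover have "(\<integral>\<^sup>+(x, y). sq_dist_cost x y \<partial>?\<pi>) =
      (\<integral>\<^sup>+(x, y). sq_dist_cost (x - a) (y - b) \<partial>\<pi>)"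
    by (subst nn_integral_distr) (simp_all add: split_beta')
  moreover have "?OT \<le> enn2ereal (\<integral>\<^sup>+(x, y). sq_dist_cost x y \<partial>?\<pi>) +
      ereal \<epsilon> * KL ?\<pi> (?\<mu> \<Otimes>\<^sub>M ?\<nu>)"
    unfolding OT_def by (rule INF_lower, rule distr_coupling[OF \<pi>]) measurable
  ultimately have "?OT + ereal ?r \<le> (enn2ereal (\<integral>\<^sup>+(x, y). sq_dist_cost (x - a) (y - b) \<partial>\<pi>) +
      ereal \<epsilon> * KL \<pi> (\<mu> \<Otimes>\<^sub>M \<nu>)) + ereal ?r"
    by (intro add_right_mono) simp
  also have "\<dots> = enn2ereal (\<integral>\<^sup>+(x, y). sq_dist_cost x y \<partial>\<pi>) + ereal \<epsilon> * KL \<pi> (\<mu> \<Otimes>\<^sub>M \<nu>)"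
    unfolding coupling_sq_dist_translate[OF \<pi> sets_borel int, of a b] by (simp add: ac_simps)
  finally show "?OT + ereal ?r \<le> \<dots>" .
qed

text \<open>The missing inequality is the previous one applied to the translated measures and the
  opposite shifts \<open>- a\<close> and \<open>- b\<close>.\<close>

lemma OT_translate:
  fixes \<mu> \<nu> :: "'a::euclidean_space measure" and a b :: 'a
  assumes prob: "prob_space \<mu>" "prob_space \<nu>"
    and sets_borel: "sets \<mu> = sets borel" "sets \<nu> = sets borel"
    and int: "integrable \<mu> (\<lambda>x. x)" "integrable \<nu> (\<lambda>x. x)"
  shows "OT sq_dist_cost \<epsilon> \<mu> \<nu> =
    OT sq_dist_cost \<epsilon> (distr \<mu> borel (\<lambda>x. x - a)) (distr \<nu> borel (\<lambda>x. x - b)) +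
      ereal (2 * (((\<integral>x. x \<partial>\<mu>) - (\<integral>x. x \<partial>\<nu>)) \<bullet> (a - b)) - (norm (a - b))\<^sup>2)"
    (is "?OT = ?OT' + ereal ?r")
proof (rule antisym)
  note [measurable_cong] = sets_borel
  interpret \<mu>: prob_space \<mu> by fact
  interpret \<nu>: prob_space \<nu> by fact
  let ?\<mu> = "distr \<mu> borel (\<lambda>x. x - a)" and ?\<nu> = "distr \<nu> borel (\<lambda>x. x - b)"
  have prob': "prob_space ?\<mu>" "prob_space ?\<nu>"
    by (auto intro!: \<mu>.prob_space_distr \<nu>.prob_space_distr)
  have int': "integrable ?\<mu> (\<lambda>x. x)" "integrable ?\<nu> (\<lambda>x. x)"
    by (subst integrable_distr_eq; simp add: int)+
  have means: "(\<integral>x. x \<partial>?\<mu>) = (\<integral>x. x \<partial>\<mu>) - a" "(\<integral>x. x \<partial>?\<nu>) = (\<integral>x. x \<partial>\<nu>) - b"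
    by (subst integral_distr; simp add: int \<mu>.prob_space \<nu>.prob_space)+
  have inverse: "distr ?\<mu> borel (\<lambda>x. x - (- a)) = \<mu>" "distr ?\<nu> borel (\<lambda>x. x - (- b)) = \<nu>"
    by (simp_all add: distr_distr comp_def distr_id2 sets_borel)
  \<comment> \<open>The difference of means has itself dropped by \<open>a - b\<close>, which
    contributes an extra 2 |a - b|^2 and turns the constant into exactly
    \<open>- ?r\<close>.\<close>
  have "2 * (((\<integral>x. x \<partial>\<mu>) - a - ((\<integral>x. x \<partial>\<nu>) - b)) \<bullet> (- a - - b)) - (norm (- a - - b))\<^sup>2 = - ?r"
    unfolding power2_norm_eq_inner
    by (simp add: inner_diff_left inner_diff_right inner_commute algebra_simps)
  then have "?OT + ereal (- ?r) \<le> ?OT'"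
    using OT_translate_le[OF prob' _ _ int', of \<epsilon> "- a" "- b"] unfolding inverse means by simp
  then show "?OT \<le> ?OT' + ereal ?r"
    \<comment> \<open>\<open>?r\<close> is real, so it can cross the inequality even at infinite
      values.\<close>
    by (cases ?OT; cases ?OT') auto
  show "?OT' + ereal ?r \<le> ?OT"
    by (rule OT_translate_le[OF prob sets_borel int])
qed

theorem proposition5p13:
  fixes \<mu>0 \<mu>1 :: "(real ^ 'n) measure" and m0 m1 :: "real ^ 'n" and \<epsilon> :: real
  assumes "\<epsilon> > 0"
    and "prob_space \<mu>0" and "sets \<mu>0 = sets borel" and "bounded (measure_support \<mu>0)"
    and "prob_space \<mu>1" and "sets \<mu>1 = sets borel" and "bounded (measure_support \<mu>1)"
    and "m0 = (\<integral>x. x \<partial>\<mu>0)" and "m1 = (\<integral>x. x \<partial>\<mu>1)"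
  shows "sinkhorn_divergence sq_dist_cost \<epsilon> \<mu>0 \<mu>1 =
    ereal ((norm (m1 - m0))\<^sup>2) +
    sinkhorn_divergence sq_dist_cost \<epsilon>
      (distr \<mu>0 borel (\<lambda>x. x - m0)) (distr \<mu>1 borel (\<lambda>x. x - m1))"
proof -
  interpret \<mu>0: prob_space \<mu>0 by fact
  interpret \<mu>1: prob_space \<mu>1 by fact
  let ?\<mu>0 = "distr \<mu>0 borel (\<lambda>x. x - m0)" and ?\<mu>1 = "distr \<mu>1 borel (\<lambda>x. x - m1)"
  have int0: "integrable \<mu>0 (\<lambda>x. x)" and int1: "integrable \<mu>1 (\<lambda>x. x)"
    using assms by (auto intro: integrable_id_bounded_support
        \<mu>0.finite_measure_axioms \<mu>1.finite_measure_axioms)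
  \<comment> \<open>With the means as shifts, the constant is 2 |m0 - m1|^2 - |m0 - m1|^2.\<close>
  have "OT sq_dist_cost \<epsilon> \<mu>0 \<mu>1 = OT sq_dist_cost \<epsilon> ?\<mu>0 ?\<mu>1 + ereal ((norm (m1 - m0))\<^sup>2)"
    using OT_translate[OF assms(2,5,3,6) int0 int1, of \<epsilon> m0 m1]
    by (simp add: assms(8,9)[symmetric] power2_norm_eq_inner[symmetric] norm_minus_commute)
  moreover have "OT sq_dist_cost \<epsilon> \<mu>0 \<mu>0 = OT sq_dist_cost \<epsilon> ?\<mu>0 ?\<mu>0"
    using OT_translate[OF assms(2,2,3,3) int0 int0, of \<epsilon> m0 m0] by (simp flip: zero_ereal_def)
  moreover have "OT sq_dist_cost \<epsilon> \<mu>1 \<mu>1 = OT sq_dist_cost \<epsilon> ?\<mu>1 ?\<mu>1"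
    using OT_translate[OF assms(5,5,6,6) int1 int1, of \<epsilon> m1 m1] by (simp flip: zero_ereal_def)
  \<comment> \<open>Subtraction is rewritten as adding the negative, so the constant moves to the
    front by associativity and commutativity alone, with no finiteness argument for the
    costs.\<close>
  ultimately show ?thesis
    by (simp add: sinkhorn_divergence_def minus_ereal_def ac_simps)
qed

end
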